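(* Let $n\geq 1$ and $k\geq 0$ be integers and let $\mathcal P\subset 2^{[n]}$ be a poset (a nonempty family of subsets of $[n]$ ordered by inclusion). For $0\leq t\leq k$ let $\beta_t=|\{\sigma\in\mathcal P:\ |\sigma|=t\}|$, and define integers $\alpha_0,\ldots,\alpha_k$ recursively by $\alpha_0=\beta_0$ and $$\alpha_t=\beta_t-\sum_{j=0}^{t-1}\binom{k-j}{t-j}\alpha_j\qquad(1\leq t\leq k).$$ If $\operatorname{sdepth}(\mathcal P)\geq k$, then $\alpha_t\geq 0$ for all $0\leq t\leq k$.
   Context: Notation: $[n]=\{1,\ldots,n\}$. For $F\subset G\subset[n]$, the interval is $[F,G]=\{\sigma\subset[n]:\ F\subset\sigma\subset G\}$. For a nonempty family $\mathcal P\subset 2^{[n]}$, a partition of $\mathcal P$ is an expression $\mathbf P:\ \mathcal P=\bigcup_{i=1}^r[F_i,G_i]$ as a disjoint union of such intervals (each contained in $\mathcal P$). Put $\operatorname{sdepth}(\mathbf P)=\min_{1\leq i\leq r}|G_i|$, and $\operatorname{sdepth}(\mathcal P)=\max\{\operatorname{sdepth}(\mathbf P):\ \mathbf P\text{ is a partition of }\mathcal P\}$. *)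

theory Defs
  imports Complex_Main "HOL-Library.Disjoint_Sets"
begin

text \<open>
  A partition into intervals is encoded by the finite set of pairs \<open>(F\<^sub>i, G\<^sub>i)\<close> of its
  end points, and \<open>[F, G]\<close> is the library's order interval \<open>{F..G}\<close> for set inclusion.
  As \<open>F \<subseteq> G\<close>, all intervals are nonempty, so disjoint intervals have different end points
  and a set of pairs represents the same data as a family indexed by \<open>1, \<dots>, r\<close>.
\<close>

definition interval_partition :: "'a set set \<Rightarrow> ('a set \<times> 'a set) set \<Rightarrow> bool" where
  "interval_partition P Q \<longleftrightarrow>
     finite Q \<and> (\<forall>(F, G)\<in>Q. F \<subseteq> G) \<and>
     disjoint_family_on (\<lambda>(F, G). {F..G}) Q \<and>
     P = (\<Union>(F, G)\<in>Q. {F..G})"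

definition sdepth_partition :: "('a set \<times> 'a set) set \<Rightarrow> nat" where
  "sdepth_partition Q = Min ((\<lambda>(F, G). card G) ` Q)"

definition sdepth :: "'a set set \<Rightarrow> nat" where
  "sdepth P = Max (sdepth_partition ` {Q. interval_partition P Q})"

text \<open>
  For a finite nonempty family, \<open>Min\<close> and \<open>Max\<close> above range over finite nonempty sets.
\<close>

lemma interval_partition_nonempty:
  assumes "interval_partition P Q" "P \<noteq> {}"
  shows "Q \<noteq> {}"
  using assms by (auto simp: interval_partition_def)

lemma interval_partition_singletons:
  assumes "finite P"
  shows "interval_partition P ((\<lambda>\<sigma>. (\<sigma>, \<sigma>)) ` P)"
  using assms by (auto simp: interval_partition_def disjoint_family_on_def)

lemma finite_interval_partitions:
  assumes "finite P"
  shows "finite {Q. interval_partition P Q}"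
proof (rule finite_subset)
  show "{Q. interval_partition P Q} \<subseteq> Pow (P \<times> P)"
  proof clarify
    fix Q F G
    assume "interval_partition P Q" "(F, G) \<in> Q"
    then have "F \<subseteq> G" "{F..G} \<subseteq> P"
      unfolding interval_partition_def by blast+
    then show "F \<in> P \<and> G \<in> P"
      by auto
  qed
qed (use assms in simp)

definition level_count :: "'a set set \<Rightarrow> nat \<Rightarrow> nat" where
  "level_count P t = card {\<sigma> \<in> P. card \<sigma> = t}"

text \<open>
  The numbers \<open>\<alpha>\<^sub>t\<close>; for \<open>t = 0\<close> the sum is empty. Only the values with \<open>t \<le> k\<close> are
  meaningful, since \<open>k - j\<close> is truncated subtraction.
\<close>

fun alpha :: "'a set set \<Rightarrow> nat \<Rightarrow> nat \<Rightarrow> int" where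
  "alpha P k t = int (level_count P t) - (\<Sum>j<t. int ((k - j) choose (t - j)) * alpha P k j)"

declare alpha.simps [simp del]

end

theory Submission
  imports Defs
begin

text \<open>
  The map \<open>P \<mapsto> \<alpha>\<^sub>t(P)\<close> is additive over disjoint unions, so it suffices to treat one
  interval \<open>[F, G]\<close> with \<open>|G| \<ge> k\<close>. If \<open>|F| > k\<close> then all \<open>\<alpha>\<^sub>t\<close> with \<open>t \<le> k\<close> vanish, and if
  \<open>|G| = k\<close> then \<open>\<alpha>\<^sub>t\<close> is \<open>1\<close> for \<open>t = |F|\<close> and \<open>0\<close> otherwise. In the remaining case, choose
  \<open>x \<in> G - F\<close> and split \<open>[F, G]\<close> into \<open>[F, G - {x}]\<close> and \<open>[F \<union> {x}, G]\<close>.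
\<close>

lemma level_count_Un_disjoint:
  assumes "finite P" "finite Q" "P \<inter> Q = {}"
  shows "level_count (P \<union> Q) t = level_count P t + level_count Q t"
proof -
  have "{\<sigma> \<in> P \<union> Q. card \<sigma> = t} = {\<sigma> \<in> P. card \<sigma> = t} \<union> {\<sigma> \<in> Q. card \<sigma> = t}"
    by auto
  moreover have "card \<dots> = card {\<sigma> \<in> P. card \<sigma> = t} + card {\<sigma> \<in> Q. card \<sigma> = t}"
    using assms by (intro card_Un_disjoint) auto
  ultimately show ?thesis
    by (simp add: level_count_def)
qed

text \<open>The recursion is linear in the level counts, with coefficients that depend only on
  \<open>k\<close>, \<open>t\<close> and \<open>j\<close>, so additivity passes from the counts to
  \<open>alpha\<close> by strong induction on \<open>t\<close>.\<close>

lemma alpha_Un_disjoint: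
  assumes "finite P" "finite Q" "P \<inter> Q = {}"
  shows "alpha (P \<union> Q) k t = alpha P k t + alpha Q k t"
proof (induction t rule: less_induct)
  case (less t)
  have "(\<Sum>j<t. int ((k - j) choose (t - j)) * alpha (P \<union> Q) k j) =
      (\<Sum>j<t. int ((k - j) choose (t - j)) * alpha P k j) +
      (\<Sum>j<t. int ((k - j) choose (t - j)) * alpha Q k j)"
    by (simp add: less.IH sum.distrib algebra_simps)
  then show ?case
    by (simp add: alpha.simps[of _ _ t] level_count_Un_disjoint[OF assms])
qed

text \<open>The recursion for \<open>alpha P k t\<close> reads only levels up to \<open>t\<close>.
  This serves the empty family and the intervals whose lower end has more than \<open>k\<close>
  elements.\<close>

lemma alpha_eq_0:
  assumes "\<And>s. s \<le> t \<Longrightarrow> level_count P s = 0"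
  shows "alpha P k t = 0"
  using assms
proof (induction t rule: less_induct)
  case (less t)
  then have "alpha P k j = 0" if "j < t" for j
    using that by simp
  then show ?case
    by (simp add: alpha.simps[of _ _ t] less.prems)
qed

lemma alpha_UN_disjoint:
  assumes "finite I" "\<And>i. i \<in> I \<Longrightarrow> finite (A i)" "disjoint_family_on A I"
  shows "alpha (\<Union>i\<in>I. A i) k t = (\<Sum>i\<in>I. alpha (A i) k t)"
  using assms
proof (induction I rule: finite_induct)
  case empty
  show ?case
    by (simp add: alpha_eq_0 level_count_def)
next
  case (insert i I)
  then have "alpha (A i \<union> (\<Union>j\<in>I. A j)) k t = alpha (A i) k t + alpha (\<Union>j\<in>I. A j) k t"
    by (intro alpha_Un_disjoint) (auto simp: disjoint_family_on_def)
  moreover have "disjoint_family_on A I"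
    using insert.prems(2) by (rule disjoint_family_on_mono[OF subset_insertI])
  ultimately show ?case
    using insert by simp
qed

lemma finite_interval_set:
  assumes "finite G"
  shows "finite {F..G}"
proof (rule finite_subset)
  show "{F..G} \<subseteq> Pow G"
    by auto
qed (use assms in simp)

lemma level_count_interval_eq_0:
  assumes "finite G" "t < card F"
  shows "level_count {F..G} t = 0"
proof -
  have "{\<sigma> \<in> {F..G}. card \<sigma> = t} = {}"
  proof safe
    fix \<sigma>
    assume "\<sigma> \<in> {F..G}" "t = card \<sigma>"
    then have "card F \<le> t"
      using assms(1) by (auto intro: card_mono finite_subset)
    then show "\<sigma> \<in> {}"
      using assms(2) by simp
  qed
  then show ?thesis
    unfolding level_count_def by (simp only: card.empty)
qed

text \<open>Deleting \<open>F\<close> identifies the members of the interval with the subsets of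
  \<open>G - F\<close>. Levels below \<open>card F\<close> are treated separately: there truncated
  subtraction would turn the binomial into 1, while the count is 0.\<close>

lemma level_count_interval:
  assumes "finite G" "F \<subseteq> G" "card F \<le> t"
  shows "level_count {F..G} t = (card G - card F) choose (t - card F)"
proof -
  have fin: "finite F" "finite (G - F)"
    using assms finite_subset by auto
  have "bij_betw (\<lambda>\<tau>. F \<union> \<tau>) {\<tau>. \<tau> \<subseteq> G - F \<and> card \<tau> = t - card F} {\<sigma> \<in> {F..G}. card \<sigma> = t}"
  proof (rule bij_betwI[where g = "\<lambda>\<sigma>. \<sigma> - F"])
    show "(\<lambda>\<tau>. F \<union> \<tau>) \<in> {\<tau>. \<tau> \<subseteq> G - F \<and> card \<tau> = t - card F} \<rightarrow> {\<sigma> \<in> {F..G}. card \<sigma> = t}"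
    proof safe
      fix \<tau> assume \<tau>: "\<tau> \<subseteq> G - F" "card \<tau> = t - card F"
      then show "F \<union> \<tau> \<in> {F..G}"
        using assms(2) by auto
      have "card (F \<union> \<tau>) = card F + card \<tau>"
        using \<tau> fin finite_subset by (intro card_Un_disjoint) auto
      then show "card (F \<union> \<tau>) = t"
        using \<tau> assms(3) by simp
    qed
    show "(\<lambda>\<sigma>. \<sigma> - F) \<in> {\<sigma> \<in> {F..G}. card \<sigma> = t} \<rightarrow> {\<tau>. \<tau> \<subseteq> G - F \<and> card \<tau> = t - card F}"
      using fin by (auto simp: card_Diff_subset)
  qed auto
  then have "level_count {F..G} t = card {\<tau>. \<tau> \<subseteq> G - F \<and> card \<tau> = t - card F}"
    unfolding level_count_def by (rule bij_betw_same_card[symmetric])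
  also have "\<dots> = (card G - card F) choose (t - card F)"
    using fin assms by (simp add: n_subsets card_Diff_subset)
  finally show ?thesis .
qed

text \<open>For \<open>k = card G\<close> the coefficient at \<open>j = card F\<close> is exactly
  the number of members of size \<open>t\<close>, so a single 1 at level \<open>card F\<close>
  accounts for all higher levels.\<close>

lemma alpha_interval_top:
  assumes "finite G" "F \<subseteq> G"
  shows "alpha {F..G} (card G) t = of_bool (t = card F)"
proof (induction t rule: less_induct)
  case (less t)
  have "(\<Sum>j<t. int ((card G - j) choose (t - j)) * alpha {F..G} (card G) j) =
      (\<Sum>j<t. if j = card F then int ((card G - j) choose (t - j)) else 0)"
    by (intro sum.cong) (simp_all add: less.IH)
  also have "\<dots> = (if card F < t then int ((card G - card F) choose (t - card F)) else 0)"
    by simp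
  \<comment> \<open>Below \<open>card F\<close> both the count and the sum are 0; at
    \<open>card F\<close> the count is 1 and the sum is 0; above it the two are the same binomial
    and cancel.\<close>
  finally show ?case
    using assms level_count_interval_eq_0[of G t F] level_count_interval[of G F t]
    by (subst alpha.simps) (cases t "card F" rule: linorder_cases; simp)
qed

lemma alpha_interval_nonneg:
  assumes "finite G" "F \<subseteq> G" "k \<le> card G" "t \<le> k"
  shows "0 \<le> alpha {F..G} k t"
  using assms
proof (induction "card (G - F)" arbitrary: F G rule: less_induct)
  case less
  consider "card G = k" | "k < card F" | "card F \<le> k" "k < card G"
    using less.prems by linarith
  then show ?case
  proof cases
    case 1
    then show ?thesis
      using alpha_interval_top[of G F t] less.prems by simp
  next
    case 2
    then show ?thesis
      using less.prems by (simp add: alpha_eq_0 level_count_interval_eq_0)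
  next
    case 3
    then have "F \<noteq> G"
      by auto
    then obtain x where x: "x \<in> G" "x \<notin> F"
      using less.prems(2) by auto
    have "card (G - {x} - F) < card (G - F)" "card (G - insert x F) < card (G - F)"
      using x less.prems(1) by (intro psubset_card_mono; blast)+
    \<comment> \<open>Since \<open>k < card G\<close>, the upper end can lose \<open>x\<close> and
      still have at least \<open>k\<close> elements; the other half keeps \<open>G\<close>. So both
      halves satisfy the induction hypothesis.\<close>
    moreover have "k \<le> card (G - {x})" "F \<subseteq> G - {x}" "insert x F \<subseteq> G"
      using x less.prems(1,2) 3 by auto
    ultimately have "0 \<le> alpha {F..G - {x}} k t" "0 \<le> alpha {insert x F..G} k t"
      using less.hyps[of "G - {x}" F] less.hyps[of G "insert x F"] less.prems by auto
    moreover have "{F..G} = {F..G - {x}} \<union> {insert x F..G}"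
      using x by auto
    moreover have "finite {F..G - {x}}" "finite {insert x F..G}"
      using less.prems(1) by (auto intro!: finite_interval_set)
    moreover have "{F..G - {x}} \<inter> {insert x F..G} = {}"
      by auto
    ultimately show ?thesis
      by (simp add: alpha_Un_disjoint)
  qed
qed

text \<open>The partition into one-point intervals shows that the \<open>Max\<close> is over a
  nonempty set, and finiteness of \<open>P\<close> bounds the number of partitions.\<close>

lemma sdepth_attained:
  assumes "finite P"
  obtains Q where "interval_partition P Q" "sdepth_partition Q = sdepth P"
proof -
  have "sdepth P \<in> sdepth_partition ` {Q. interval_partition P Q}"
    unfolding sdepth_def
    using finite_interval_partitions[OF assms] interval_partition_singletons[OF assms]
    by (intro Max_in) auto
  then show ?thesis
    using that by auto
qed

theorem theorem2p4:
  fixes n k :: nat and P :: "nat set set"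
  assumes "n \<ge> 1"
    and "P \<subseteq> Pow {1..n}"
    and "P \<noteq> {}"
    and "sdepth P \<ge> k"
  shows "\<forall>t\<le>k. alpha P k t \<ge> 0"
proof (intro allI impI)
  fix t
  assume "t \<le> k"
  have "finite P"
    using assms(2) by (rule finite_subset) simp
  then obtain Q where Q: "interval_partition P Q" and "sdepth_partition Q = sdepth P"
    by (rule sdepth_attained)
  \<comment> \<open>Every upper end is at least as large as the minimum over \<open>Q\<close>, which
    equals \<open>sdepth P\<close> by the choice of \<open>Q\<close>.\<close>
  then have k: "k \<le> card G" if "(F, G) \<in> Q" for F G
  proof -
    have "finite Q"
      using Q by (simp add: interval_partition_def)
    then have "sdepth_partition Q \<le> card G"
      unfolding sdepth_partition_def using imageI[OF that, of "\<lambda>(F, G). card G"]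
      by (intro Min_le) auto
    then show ?thesis
      using \<open>sdepth_partition Q = sdepth P\<close> assms(4) by simp
  qed
  have sub: "F \<subseteq> G" "{F..G} \<subseteq> P" if "(F, G) \<in> Q" for F G
    using Q that unfolding interval_partition_def by blast+
  have fin: "finite G" if "(F, G) \<in> Q" for F G
  proof -
    have "G \<in> P"
      using sub[OF that] by auto
    then show ?thesis
      using assms(2) finite_subset[of G "{1..n}"] by auto
  qed
  have "alpha P k t = alpha (\<Union>(F, G)\<in>Q. {F..G}) k t"
    using Q by (simp add: interval_partition_def)
  also have "\<dots> = (\<Sum>(F, G)\<in>Q. alpha {F..G} k t)"
  proof (subst alpha_UN_disjoint)
    show "finite (case i of (F, G) \<Rightarrow> {F..G})" if "i \<in> Q" for i
      using that by (cases i) (auto intro: finite_interval_set fin)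
  qed (use Q in \<open>simp_all add: interval_partition_def case_prod_beta\<close>)
  also have "\<dots> \<ge> 0"
    using alpha_interval_nonneg[OF fin sub(1) k \<open>t \<le> k\<close>] by (auto intro!: sum_nonneg)
  finally show "alpha P k t \<ge> 0" .
qed

end
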